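(* Let $G$ be a groupoid, let $R$ be a ring strongly graded by $G$, and let $\sigma_s:R\to R$, $s\in G$, be the functions induced by the grading. Then the center of $R$ equals the collection of all sums $\sum_{e\in\mathrm{ob}(G)}x_e$, where $x_e\in C_R(R_e)$ for $e\in\mathrm{ob}(G)$, satisfying $\sigma_s(x_{d(s)})=x_{c(s)}$ for all $s\in G$. In particular, if $G$ is the disjoint union of groups $G_e$, $e\in\mathrm{ob}(G)$, then the center of $R$ equals the direct sum of the rings $C_R(R_e)^{G_e}$, $e\in\mathrm{ob}(G)$.
   Context: All rings are associative and unital, with nonzero identity. For a subset $S$ of a ring $R$, $C_R(S)$ denotes the commutant of $S$ in $R$, i.e. the set of elements of $R$ commuting with every element of $S$. For a category $G$, an object is identified with its identity morphism, $s\in G$ means that $s$ is a morphism, $d(s)$ and $c(s)$ are the domain and codomain of $s$, and $G^{(2)}$ is the set of pairs $(s,t)$ of morphisms with $d(s)=c(t)$ (with composite $st$). A groupoid is a category in which all morphisms are invertible. A ring $R$ is graded by $G$ if there are additive subgroups $R_s$, $s\in G$, of $R$ with $R=\bigoplus_{s\in G}R_s$ and, for all $s,t\in G$, $R_sR_t\subseteq R_{st}$ if $(s,t)\in G^{(2)}$ and $R_sR_t=\{0\}$ otherwise; it is strongly graded if $R_sR_t=R_{st}$ for all $(s,t)\in G^{(2)}$ (with $R_sR_t$ the additive group generated by the products). One writes $1_R=\sum_{s\in G}1_s$ with $1_s\in R_s$; in particular $1_e$ is the degree $e$ component of $1_R$ for $e\in\mathrm{ob}(G)$. The functions $\sigma_s$: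 for each $s\in G$ and each positive integer $i$ take $a_s^{(i)}\in R_s$ and $b_{s^{-1}}^{(i)}\in R_{s^{-1}}$ with $a_s^{(i)}=b_{s^{-1}}^{(i)}=0$ for all but finitely many $i$ and $\sum_{i=1}^{\infty}a_s^{(i)}b_{s^{-1}}^{(i)}=1_{c(s)}$ (possible by strong gradedness). Define $\sigma_s:R\to R$ by $\sigma_s(x)=\sum_{i=1}^{\infty}a_s^{(i)}xb_{s^{-1}}^{(i)}$, $x\in R$. Restrictions of $\sigma_s$ to subsets of $R$ are also denoted $\sigma_s$. In the second assertion, $G_e$ denotes the group of morphisms of $G$ with domain and codomain $e$ (every morphism of $G$ lies in some $G_e$), and $C_R(R_e)^{G_e}=\{x\in C_R(R_e): \sigma_s(x)=x \text{ for all } s\in G_e\}$, including $s=e$. *)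

theory Defs
  imports
    "HOL-Library.Groups_Big_Fun"
    "HOL-Computational_Algebra.Group_Closure"
begin

section \<open>Groupoids\<close>

text \<open>
  Small categories in single-sorted form: an object is identified with its identity morphism,
  so \<open>src\<close> and \<open>tgt\<close> (domain and codomain) take values in the set of morphisms. The composite
  \<open>cmp G s t\<close> is meaningful only for \<open>src G s = tgt G t\<close>.
\<close>

record 'g category =
  Mor :: "'g set"
  src :: "'g \<Rightarrow> 'g"
  tgt :: "'g \<Rightarrow> 'g"
  cmp :: "'g \<Rightarrow> 'g \<Rightarrow> 'g"

locale category =
  fixes G :: "('g, 'm) category_scheme" (structure)
  assumes src_closed: "s \<in> Mor G \<Longrightarrow> src G s \<in> Mor G"
    and tgt_closed: "s \<in> Mor G \<Longrightarrow> tgt G s \<in> Mor G"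
    and src_src: "s \<in> Mor G \<Longrightarrow> src G (src G s) = src G s"
    and tgt_src: "s \<in> Mor G \<Longrightarrow> tgt G (src G s) = src G s"
    and src_tgt: "s \<in> Mor G \<Longrightarrow> src G (tgt G s) = tgt G s"
    and tgt_tgt: "s \<in> Mor G \<Longrightarrow> tgt G (tgt G s) = tgt G s"
    and cmp_closed: "\<lbrakk>s \<in> Mor G; t \<in> Mor G; src G s = tgt G t\<rbrakk> \<Longrightarrow> cmp G s t \<in> Mor G"
    and src_cmp: "\<lbrakk>s \<in> Mor G; t \<in> Mor G; src G s = tgt G t\<rbrakk> \<Longrightarrow> src G (cmp G s t) = src G t"
    and tgt_cmp: "\<lbrakk>s \<in> Mor G; t \<in> Mor G; src G s = tgt G t\<rbrakk> \<Longrightarrow> tgt G (cmp G s t) = tgt G s"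
    and cmp_assoc: "\<lbrakk>r \<in> Mor G; s \<in> Mor G; t \<in> Mor G; src G r = tgt G s; src G s = tgt G t\<rbrakk>
          \<Longrightarrow> cmp G (cmp G r s) t = cmp G r (cmp G s t)"
    and cmp_tgt: "s \<in> Mor G \<Longrightarrow> cmp G (tgt G s) s = s"
    and cmp_src: "s \<in> Mor G \<Longrightarrow> cmp G s (src G s) = s"

definition ob :: "('g, 'm) category_scheme \<Rightarrow> 'g set" where
  "ob G = {e \<in> Mor G. src G e = e \<and> tgt G e = e}"

definition is_inverse :: "('g, 'm) category_scheme \<Rightarrow> 'g \<Rightarrow> 'g \<Rightarrow> bool" where
  "is_inverse G s t \<longleftrightarrow> t \<in> Mor G \<and> src G t = tgt G s \<and> tgt G t = src G s
     \<and> cmp G s t = tgt G s \<and> cmp G t s = src G s"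

locale groupoid = category +
  assumes inverse_exists: "s \<in> Mor G \<Longrightarrow> \<exists>t. is_inverse G s t"

definition minv :: "('g, 'm) category_scheme \<Rightarrow> 'g \<Rightarrow> 'g" where
  "minv G s = (THE t. is_inverse G s t)"

definition vertex_group :: "('g, 'm) category_scheme \<Rightarrow> 'g \<Rightarrow> 'g set" where
  "vertex_group G e = {s \<in> Mor G. src G s = e \<and> tgt G s = e}"

definition disjoint_union_of_groups :: "('g, 'm) category_scheme \<Rightarrow> bool" where
  "disjoint_union_of_groups G \<longleftrightarrow> Mor G = (\<Union>e\<in>ob G. vertex_group G e)"


section \<open>Internal direct sums\<close>

definition add_subgroup :: "'a::ab_group_add set \<Rightarrow> bool" where
  "add_subgroup A \<longleftrightarrow> 0 \<in> A \<and> (\<forall>x\<in>A. \<forall>y\<in>A. x - y \<in> A)"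

text \<open>
  The finitely supported families \<open>(x\<^sub>i)\<close> with \<open>x\<^sub>i \<in> A\<^sub>i\<close>, i.e. the external direct sum; families
  are extended by zero outside the index set so that they are determined by their entries.
  On them, \<^const>\<open>Sum_any\<close> is the honest finite sum of the entries.
\<close>

definition fin_families :: "'i set \<Rightarrow> ('i \<Rightarrow> 'a::zero set) \<Rightarrow> ('i \<Rightarrow> 'a) set" where
  "fin_families I A =
     {x. (\<forall>i\<in>I. x i \<in> A i) \<and> (\<forall>i. i \<notin> I \<longrightarrow> x i = 0) \<and> finite {i. x i \<noteq> 0}}"

definition direct_sum :: "'i set \<Rightarrow> ('i \<Rightarrow> 'a::ab_group_add set) \<Rightarrow> 'a set \<Rightarrow> bool" where
  "direct_sum I A S \<longleftrightarrow>
     (\<forall>i\<in>I. add_subgroup (A i)) \<and> bij_betw Sum_any (fin_families I A) S"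

text \<open>
  A subset that is a unital ring under the ambient operations. Its identity need not be \<open>1\<close>, and
  the zero ring is allowed: \<open>C\<^sub>R(R\<^sub>e)\<^bsup>G\<^sub>e\<^esup>\<close> has identity \<open>1\<^sub>e\<close>, which may be \<open>0\<close>.
\<close>

definition ring_in :: "'a::ring_1 set \<Rightarrow> bool" where
  "ring_in A \<longleftrightarrow> add_subgroup A \<and> (\<forall>x\<in>A. \<forall>y\<in>A. x * y \<in> A)
     \<and> (\<exists>u\<in>A. \<forall>x\<in>A. u * x = x \<and> x * u = x)"

text \<open>Addition and multiplication in a direct sum of rings are componentwise.\<close>

definition ring_direct_sum :: "'i set \<Rightarrow> ('i \<Rightarrow> 'a::ring_1 set) \<Rightarrow> 'a set \<Rightarrow> bool" where
  "ring_direct_sum I A S \<longleftrightarrow>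
     direct_sum I A S \<and> (\<forall>i\<in>I. ring_in (A i)) \<and>
     (\<forall>x \<in> fin_families I A. \<forall>y \<in> fin_families I A.
        Sum_any x * Sum_any y = Sum_any (\<lambda>i. x i * y i))"


section \<open>Strongly graded rings\<close>

definition commutant :: "'a::ring_1 set \<Rightarrow> 'a set" where
  "commutant S = {x. \<forall>y\<in>S. x * y = y * x}"

definition ring_center :: "'a::ring_1 set" where
  "ring_center = commutant UNIV"

definition set_prod :: "'a::ring_1 set \<Rightarrow> 'a set \<Rightarrow> 'a set" where
  "set_prod A B = group_closure {x * y | x y. x \<in> A \<and> y \<in> B}"

definition graded :: "('g, 'm) category_scheme \<Rightarrow> ('g \<Rightarrow> 'a::ring_1 set) \<Rightarrow> bool" where
  "graded G R \<longleftrightarrow> direct_sum (Mor G) R UNIV \<and>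
     (\<forall>s\<in>Mor G. \<forall>t\<in>Mor G.
        if src G s = tgt G t then set_prod (R s) (R t) \<subseteq> R (cmp G s t)
        else set_prod (R s) (R t) = {0})"

definition strongly_graded :: "('g, 'm) category_scheme \<Rightarrow> ('g \<Rightarrow> 'a::ring_1 set) \<Rightarrow> bool" where
  "strongly_graded G R \<longleftrightarrow> graded G R \<and>
     (\<forall>s\<in>Mor G. \<forall>t\<in>Mor G. src G s = tgt G t \<longrightarrow> set_prod (R s) (R t) = R (cmp G s t))"

definition component ::
    "('g, 'm) category_scheme \<Rightarrow> ('g \<Rightarrow> 'a::ring_1 set) \<Rightarrow> 'a \<Rightarrow> 'g \<Rightarrow> 'a" where
  "component G R r = the_inv_into (fin_families (Mor G) R) Sum_any r"

text \<open>
  The elements \<open>a\<^sub>s\<^sup>(\<^sup>i\<^sup>)\<close> and \<open>b\<^sub>t\<^sup>(\<^sup>i\<^sup>)\<close> are \<open>a s i\<close> and \<open>b t i\<close>; the index \<open>i\<close> starts at \<open>0\<close>.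
\<close>

definition sigma_data :: "('g, 'm) category_scheme \<Rightarrow> ('g \<Rightarrow> 'a::ring_1 set)
    \<Rightarrow> ('g \<Rightarrow> nat \<Rightarrow> 'a) \<Rightarrow> ('g \<Rightarrow> nat \<Rightarrow> 'a) \<Rightarrow> bool" where
  "sigma_data G R a b \<longleftrightarrow> (\<forall>s\<in>Mor G.
     (\<forall>i. a s i \<in> R s \<and> b (minv G s) i \<in> R (minv G s)) \<and>
     finite {i. \<not> (a s i = 0 \<and> b (minv G s) i = 0)} \<and>
     Sum_any (\<lambda>i. a s i * b (minv G s) i) = component G R 1 (tgt G s))"

definition sigma :: "('g, 'm) category_scheme
    \<Rightarrow> ('g \<Rightarrow> nat \<Rightarrow> 'a::ring_1) \<Rightarrow> ('g \<Rightarrow> nat \<Rightarrow> 'a) \<Rightarrow> 'g \<Rightarrow> 'a \<Rightarrow> 'a" where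
  "sigma G a b s x = Sum_any (\<lambda>i. a s i * x * b (minv G s) i)"

definition invariants :: "('g, 'm) category_scheme \<Rightarrow> ('g \<Rightarrow> 'a::ring_1 set)
    \<Rightarrow> ('g \<Rightarrow> nat \<Rightarrow> 'a) \<Rightarrow> ('g \<Rightarrow> nat \<Rightarrow> 'a) \<Rightarrow> 'g \<Rightarrow> 'a set" where
  "invariants G R a b e =
     {x \<in> commutant (R e). \<forall>s\<in>vertex_group G e. sigma G a b s x = x}"


section \<open>Compatible families are finitely supported\<close>

lemma (in groupoid) minv_ob:
  assumes "e \<in> ob G"
  shows "minv G e = e"
proof -
  have e: "e \<in> Mor G" "src G e = e" "tgt G e = e"
    using assms by (auto simp: ob_def)
  have ee: "cmp G e e = e"
    using cmp_src[OF e(1)] e by simp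
  show ?thesis
    unfolding minv_def
  proof (rule the_equality)
    show "is_inverse G e e"
      using e ee by (simp add: is_inverse_def)
    show "t = e" if "is_inverse G e t" for t
      using that e cmp_tgt[of t] by (auto simp: is_inverse_def)
  qed
qed

text \<open>
  Restricting to finitely supported families in the description of the center loses nothing:
  the condition \<open>\<sigma>\<^sub>s(x\<^bsub>d(s)\<^esub>) = x\<^bsub>c(s)\<^esub>\<close> for identities \<open>s = e\<close> gives \<open>x\<^sub>e = x\<^sub>e1\<^sub>e\<close>.
\<close>

lemma compatible_finite_support:
  fixes R :: "'g \<Rightarrow> 'a::ring_1 set"
  assumes "groupoid G" "strongly_graded G R" "sigma_data G R a b"
    and x: "\<forall>e\<in>ob G. x e \<in> commutant (R e)"
    and comp: "\<forall>s\<in>Mor G. sigma G a b s (x (src G s)) = x (tgt G s)"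
  shows "finite {e \<in> ob G. x e \<noteq> 0}"
proof -
  interpret groupoid G by fact
  have bij: "bij_betw Sum_any (fin_families (Mor G) R) (UNIV :: 'a set)"
    using assms(2) by (simp add: strongly_graded_def graded_def direct_sum_def)
  have "component G R 1 \<in> fin_families (Mor G) R"
    using bij_betw_the_inv_into[OF bij] unfolding component_def bij_betw_def by blast
  then have fin: "finite {e. component G R 1 e \<noteq> 0}"
    by (simp add: fin_families_def)
  have "x e = x e * component G R 1 e" if "e \<in> ob G" for e
  proof -
    have e: "e \<in> Mor G" "src G e = e" "tgt G e = e"
      using that by (auto simp: ob_def)
    note inv = minv_ob[OF that]
    have dat: "\<And>i. a e i \<in> R e" "finite {i. \<not> (a e i = 0 \<and> b e i = 0)}"
      "Sum_any (\<lambda>i. a e i * b e i) = component G R 1 e"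
      using assms(3) e inv unfolding sigma_data_def by (auto dest!: bspec[of _ _ e])
    have fin': "finite {i. a e i * b e i \<noteq> 0}"
      by (rule finite_subset[OF _ dat(2)]) auto
    have "x e = Sum_any (\<lambda>i. a e i * x e * b e i)"
      using comp e inv unfolding sigma_def by (auto dest!: bspec[of _ _ e])
    also have "\<dots> = Sum_any (\<lambda>i. x e * (a e i * b e i))"
      using x that dat(1) by (simp add: commutant_def mult.assoc[symmetric])
    also have "\<dots> = x e * component G R 1 e"
      using Sum_any_right_distrib[OF fin', of "x e"] dat(3) by simp
    finally show ?thesis .
  qed
  then have "{e \<in> ob G. x e \<noteq> 0} \<subseteq> {e. component G R 1 e \<noteq> 0}"
    by (auto intro: ccontr) (metis mult_zero_right)
  then show ?thesis
    using fin finite_subset by blast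
qed

end

theory Submission
  imports Defs
begin

text \<open>
  The whole argument rests on one fact about the identity element: \<open>1 = \<Sum>\<^sub>e 1\<^sub>e\<close>, the sum ranging
  over objects only, and \<open>1\<^bsub>c(s)\<^esub>y = y = y1\<^bsub>d(s)\<^esub>\<close> for \<open>y\<close> of degree \<open>s\<close>. Cancellation in the
  groupoid gives this: multiplying \<open>y\<close> by \<open>1 = \<Sum>\<^sub>t 1\<^sub>t\<close> puts the summands \<open>y1\<^sub>t\<close> in pairwise
  different degrees \<open>st\<close>, so comparing with \<open>y\<close> leaves only the term with \<open>st = s\<close>.
  The equation \<open>1\<^bsub>c(s)\<^esub>y = y\<close> then follows because no other object composes with \<open>s\<close> on the left.
  The lemmas are \<open>component_mult_homogeneous\<close>, \<open>homogeneous_mult_component_one\<close>,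
  \<open>component_one_not_ob\<close> and \<open>component_one_mult_homogeneous\<close>.

  If \<open>x\<close> is central, its pieces \<open>x1\<^sub>e\<close> commute with \<open>R\<^sub>e\<close>, and since \<open>x\<close> can be pulled out of
  \<open>\<sigma>\<^sub>s\<close>, both sides of the compatibility condition become \<open>x1\<^bsub>c(s)\<^esub>\<close>
  (\<open>central_imp_commutant_family\<close>, \<open>sigma_central\<close>). Conversely let \<open>(x\<^sub>e)\<close> be
  compatible. The condition at the identities \<open>s = e\<close> forces \<open>x\<^sub>e = x\<^sub>e1\<^sub>e = 1\<^sub>ex\<^sub>e\<close>, so against \<open>y\<close> of degree \<open>s : f \<rightarrow> e\<close> only
  \<open>x\<^sub>e\<close> survives on the left and only \<open>x\<^sub>f\<close> on the right, and
  \<open>x\<^sub>ey = \<sigma>\<^sub>s(x\<^sub>f)y = \<Sum>\<^sub>i a\<^sub>ix\<^sub>f(b\<^sub>iy) = \<Sum>\<^sub>i a\<^sub>ib\<^sub>iyx\<^sub>f = yx\<^sub>f\<close>,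
  because each \<open>b\<^sub>iy\<close> lies in \<open>R\<^sub>f\<close> (\<open>sigma_mult_homogeneous\<close>, \<open>compatible_sum_central\<close>).

  When every morphism is an endomorphism, compatibility decouples into one invariance condition per
  object. Moreover \<open>1\<^sub>e\<close> is then central, and the invariants at \<open>e\<close> are exactly the corner
  \<open>{x \<in> Z(R). x1\<^sub>e = x}\<close> of the center (\<open>invariants_eq\<close>). The second assertion thereby becomes
  the decomposition of the center along the orthogonal central idempotents \<open>1\<^sub>e\<close>.
\<close>

section \<open>Inverses in a groupoid\<close>

context groupoid
begin

lemma is_inverse_minv:
  assumes s: "s \<in> Mor G"
  shows "is_inverse G s (minv G s)"
proof -
  obtain t where t: "is_inverse G s t"
    using inverse_exists[OF s] by blast
  have "u = t" if u: "is_inverse G s u" for u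
  proof -
    have "u = cmp G u (cmp G s t)"
      using t u cmp_src[of u] by (simp add: is_inverse_def)
    also have "\<dots> = cmp G (cmp G u s) t"
      using t u s cmp_assoc[of u s t] by (simp add: is_inverse_def)
    also have "\<dots> = t"
      using t u cmp_tgt[of t] by (simp add: is_inverse_def)
    finally show ?thesis .
  qed
  with t show ?thesis
    unfolding minv_def by (metis theI)
qed

lemma cmp_left_cancel:
  assumes "t \<in> Mor G" "s \<in> Mor G" "u \<in> Mor G" "src G t = tgt G s" "src G t = tgt G u"
    and eq: "cmp G t s = cmp G t u"
  shows "s = u"
proof -
  note inv = is_inverse_minv[OF assms(1), unfolded is_inverse_def]
  have "v = cmp G (minv G t) (cmp G t v)" if "v \<in> Mor G" "src G t = tgt G v" for v
    using inv that assms(1) cmp_assoc[of "minv G t" t v] cmp_tgt[of v] by simp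
  then show ?thesis
    using assms by metis
qed

lemma src_in_ob: "s \<in> Mor G \<Longrightarrow> src G s \<in> ob G"
  by (simp add: ob_def src_closed src_src tgt_src)

lemma tgt_in_ob: "s \<in> Mor G \<Longrightarrow> tgt G s \<in> ob G"
  by (simp add: ob_def tgt_closed src_tgt tgt_tgt)

end


section \<open>Homogeneous components\<close>

lemma add_subgroup_zero: "add_subgroup A \<Longrightarrow> 0 \<in> A"
  by (simp add: add_subgroup_def)

lemma add_subgroup_add:
  assumes "add_subgroup A" "x \<in> A" "y \<in> A"
  shows "x + y \<in> A"
proof -
  have "x - (0 - y) \<in> A"
    using assms unfolding add_subgroup_def by blast
  then show ?thesis
    by simp
qed

lemma add_subgroup_commutant: "add_subgroup (commutant S)"
  by (auto simp: add_subgroup_def commutant_def algebra_simps)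

lemma ring_center_iff: "x \<in> ring_center \<longleftrightarrow> (\<forall>y. x * y = y * x)"
  by (simp add: ring_center_def commutant_def)

locale groupoid_graded_ring = groupoid G for G :: "('g, 'm) category_scheme" (structure) +
  fixes R :: "'g \<Rightarrow> 'a::ring_1 set"
  assumes graded: "graded G R"
begin

abbreviation part :: "'a \<Rightarrow> 'g \<Rightarrow> 'a" where
  "part \<equiv> component G R"

lemma bij_Sum_any: "bij_betw Sum_any (fin_families (Mor G) R) UNIV"
  using graded by (simp add: graded_def direct_sum_def)

lemma add_subgroup_R: "s \<in> Mor G \<Longrightarrow> add_subgroup (R s)"
  using graded by (simp add: graded_def direct_sum_def)

lemma part_family: "part r \<in> fin_families (Mor G) R"
  using bij_betw_the_inv_into[OF bij_Sum_any] unfolding component_def bij_betw_def by blast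

lemma part_mem: "s \<in> Mor G \<Longrightarrow> part r s \<in> R s"
  using part_family[of r] by (simp add: fin_families_def)

lemma part_outside: "s \<notin> Mor G \<Longrightarrow> part r s = 0"
  using part_family[of r] by (simp add: fin_families_def)

lemma finite_part: "finite {s. part r s \<noteq> 0}"
  using part_family[of r] by (simp add: fin_families_def)

lemma Sum_any_part: "Sum_any (part r) = r"
  unfolding component_def
  by (rule f_the_inv_into_f_bij_betw[OF bij_Sum_any]) simp

lemma part_unique:
  assumes "f \<in> fin_families (Mor G) R" "Sum_any f = r"
  shows "part r = f"
  unfolding component_def assms(2)[symmetric]
  by (rule the_inv_into_f_f) (use bij_Sum_any assms(1) in \<open>auto simp: bij_betw_def\<close>)

lemma part_homogeneous:
  assumes "s \<in> Mor G" "x \<in> R s"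
  shows "part x u = (if u = s then x else 0)"
proof -
  have "(\<lambda>u. if u = s then x else 0) \<in> fin_families (Mor G) R"
    using assms add_subgroup_zero[OF add_subgroup_R] by (auto simp: fin_families_def)
  moreover have "Sum_any (\<lambda>u. if u = s then x else 0) = x"
    by simp
  ultimately have "part x = (\<lambda>u. if u = s then x else 0)"
    by (rule part_unique)
  then show ?thesis
    by simp
qed

lemma part_zero: "part 0 u = 0"
proof -
  have "part 0 = (\<lambda>_. 0)"
    using add_subgroup_zero[OF add_subgroup_R]
    by (intro part_unique) (auto simp: fin_families_def)
  then show ?thesis
    by simp
qed

lemma part_add: "part (x + y) u = part x u + part y u"
proof -
  have "part (x + y) = (\<lambda>u. part x u + part y u)"
  proof (rule part_unique)
    have "finite {u. part x u + part y u \<noteq> 0}"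
      by (rule finite_subset[OF _ finite_UnI[OF finite_part[of x] finite_part[of y]]]) auto
    then show "(\<lambda>u. part x u + part y u) \<in> fin_families (Mor G) R"
      by (simp add: fin_families_def part_mem part_outside add_subgroup_add add_subgroup_R)
    show "Sum_any (\<lambda>u. part x u + part y u) = x + y"
      by (simp add: Sum_any.distrib finite_part Sum_any_part)
  qed
  then show ?thesis
    by simp
qed

lemma part_sum: "part (\<Sum>i\<in>A. f i) u = (\<Sum>i\<in>A. part (f i) u)"
  by (induction A rule: infinite_finite_induct) (simp_all add: part_zero part_add)

lemma sum_part: "(\<Sum>s\<in>{s. part r s \<noteq> 0}. part r s) = r"
  using Sum_any_part[of r] by (simp add: Sum_any.expand_set)

lemma mult_mem:
  assumes "s \<in> Mor G" "t \<in> Mor G" "src G s = tgt G t" "x \<in> R s" "y \<in> R t"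
  shows "x * y \<in> R (cmp G s t)"
proof -
  have "x * y \<in> set_prod (R s) (R t)"
    using assms unfolding set_prod_def by (blast intro: group_closure.base)
  then show ?thesis
    using graded assms unfolding graded_def by (auto split: if_splits)
qed

lemma mult_not_composable:
  assumes "s \<in> Mor G" "t \<in> Mor G" "src G s \<noteq> tgt G t" "x \<in> R s" "y \<in> R t"
  shows "x * y = 0"
proof -
  have "x * y \<in> set_prod (R s) (R t)"
    using assms unfolding set_prod_def by (blast intro: group_closure.base)
  moreover have "set_prod (R s) (R t) = {0}"
    using graded assms unfolding graded_def by meson
  ultimately show ?thesis
    by simp
qed

text \<open>
  Left multiplication by \<open>x \<in> R\<^sub>t\<close> moves degree \<open>s\<close> to degree \<open>ts\<close>; by cancellation no two degrees
  are merged, so no other component of \<open>r\<close> contributes to degree \<open>ts\<close>.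
\<close>

lemma component_mult_homogeneous:
  assumes t: "t \<in> Mor G" and s: "s \<in> Mor G" and ts: "src G t = tgt G s" and x: "x \<in> R t"
  shows "part (x * r) (cmp G t s) = x * part r s"
proof -
  let ?S = "{u. part r u \<noteq> 0}"
  have summand: "part (x * part r u) (cmp G t s) = (if u = s then x * part r u else 0)"
    if "u \<in> ?S" for u
  proof -
    have u: "u \<in> Mor G"
      using that part_outside by auto
    show ?thesis
    proof (cases "src G t = tgt G u")
      case True
      have "x * part r u \<in> R (cmp G t u)" "cmp G t u \<in> Mor G"
        using mult_mem[OF t u True x part_mem[OF u]] cmp_closed[OF t u True] by auto
      moreover have "cmp G t s = cmp G t u \<longleftrightarrow> u = s"
        using cmp_left_cancel[OF t s u ts True] by auto
      ultimately show ?thesis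
        by (simp add: part_homogeneous)
    next
      case False
      then show ?thesis
        using mult_not_composable[OF t u _ x part_mem[OF u]] ts by (auto simp: part_zero)
    qed
  qed
  have "x * r = (\<Sum>u\<in>?S. x * part r u)"
    using sum_part[of r] by (simp flip: sum_distrib_left)
  then have "part (x * r) (cmp G t s) = (\<Sum>u\<in>?S. if u = s then x * part r u else 0)"
    using summand by (simp add: part_sum)
  also have "\<dots> = x * part r s"
    using finite_part[of r] by simp
  finally show ?thesis .
qed


section \<open>The components of the identity\<close>

abbreviation unit_at :: "'g \<Rightarrow> 'a" where
  "unit_at \<equiv> part 1"

text \<open>
  In \<open>x = x1\<close> the part of degree \<open>ts\<close> is \<open>x1\<^sub>s\<close>, and \<open>ts = t\<close> happens only for \<open>s = d(t)\<close>.
\<close>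

lemma homogeneous_mult_component_one:
  assumes t: "t \<in> Mor G" and x: "x \<in> R t" and s: "s \<in> Mor G"
  shows "x * unit_at s = (if s = src G t then x else 0)"
proof (cases "src G t = tgt G s")
  case True
  have "x * unit_at s = part x (cmp G t s)"
    using component_mult_homogeneous[OF t s True x, of 1] by simp
  moreover have "cmp G t s = t \<longleftrightarrow> s = src G t"
  proof
    assume "cmp G t s = t"
    then show "s = src G t"
      by (intro cmp_left_cancel[OF t s src_closed[OF t] True]) (simp_all only: cmp_src[OF t] tgt_src[OF t])
  next
    assume "s = src G t"
    then show "cmp G t s = t"
      using cmp_src[OF t] by (simp only:)
  qed
  ultimately show ?thesis
    by (simp only: part_homogeneous[OF t x])
next
  case False
  then have "s \<noteq> src G t"
    using tgt_src[OF t] by metis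
  then show ?thesis
    using mult_not_composable[OF t s False x part_mem[OF s]] by (simp only: if_False)
qed

text \<open>
  A component \<open>1\<^sub>s\<close> with \<open>s\<close> not an identity is killed by every homogeneous element on its left,
  hence by \<open>1\<close>.
\<close>

lemma component_one_not_ob:
  assumes "s \<notin> ob G"
  shows "unit_at s = 0"
proof (cases "s \<in> Mor G")
  case True
  have "unit_at s = (\<Sum>t\<in>{t. unit_at t \<noteq> 0}. unit_at t) * unit_at s"
    by (simp add: sum_part)
  also have "\<dots> = (\<Sum>t\<in>{t. unit_at t \<noteq> 0}. unit_at t * unit_at s)"
    by (simp add: sum_distrib_right)
  also have "\<dots> = 0"
  proof (rule sum.neutral, rule ballI)
    fix t assume "t \<in> {t. unit_at t \<noteq> 0}"
    then have t: "t \<in> Mor G"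
      using part_outside by auto
    then have "s \<noteq> src G t"
      using assms src_in_ob by auto
    then show "unit_at t * unit_at s = 0"
      using homogeneous_mult_component_one[OF t part_mem[OF t] True] by simp
  qed
  finally show ?thesis .
qed (simp add: part_outside)

text \<open>
  Since \<open>1\<close> is a sum over objects, so is \<open>x = \<Sum>\<^sub>u 1\<^sub>ux\<close>, and composability alone isolates one
  term: \<open>c(t)\<close> is the only object that can be composed with \<open>t\<close> on the left.
\<close>

lemma component_one_mult_homogeneous:
  assumes t: "t \<in> Mor G" and x: "x \<in> R t" and e: "e \<in> ob G"
  shows "unit_at e * x = (if e = tgt G t then x else 0)"
proof -
  have off: "unit_at u * x = 0" if "u \<in> ob G" "u \<noteq> tgt G t" for u
  proof -
    have u: "u \<in> Mor G" "src G u = u"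
      using that(1) by (simp_all add: ob_def)
    show ?thesis
      using that(2) u mult_not_composable[OF u(1) t _ part_mem[OF u(1)] x] by metis
  qed
  have "x = (\<Sum>u\<in>{u. unit_at u \<noteq> 0}. unit_at u * x)"
    using sum_part[of 1] by (simp flip: sum_distrib_right)
  also have "\<dots> = (\<Sum>u\<in>{u. unit_at u \<noteq> 0}. if u = tgt G t then unit_at u * x else 0)"
    using off component_one_not_ob by (intro sum.cong refl) (metis mult_zero_left)
  also have "\<dots> = unit_at (tgt G t) * x"
    using finite_part[of 1] by simp
  finally show ?thesis
    using off[OF e] by metis
qed

lemma ob_imp_Mor: "e \<in> ob G \<Longrightarrow> e \<in> Mor G"
  by (simp add: ob_def)

lemma component_one_orthogonal:
  assumes "e \<in> ob G" "f \<in> ob G"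
  shows "unit_at e * unit_at f = (if f = e then unit_at e else 0)"
  using homogeneous_mult_component_one[OF _ part_mem, of e f 1] assms by (simp add: ob_def)

lemma Sum_any_mult_component_one: "Sum_any (\<lambda>e. x * unit_at e) = x"
  using Sum_any_right_distrib[OF finite_part[of 1], of x] by (simp add: Sum_any_part)

lemma central_if_commutes_homogeneous:
  assumes "\<And>s y. s \<in> Mor G \<Longrightarrow> y \<in> R s \<Longrightarrow> x * y = y * x"
  shows "x \<in> ring_center"
  unfolding ring_center_iff
proof
  fix y
  have eq: "x * part y s = part y s * x" for s
    using assms[OF _ part_mem] part_outside[of s y] by (cases "s \<in> Mor G") auto
  have "x * y = (\<Sum>s\<in>{s. part y s \<noteq> 0}. x * part y s)"
    using sum_part[of y] by (simp flip: sum_distrib_left)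
  also have "\<dots> = (\<Sum>s\<in>{s. part y s \<noteq> 0}. part y s * x)"
    by (simp add: eq)
  also have "\<dots> = y * x"
    using sum_part[of y] by (simp flip: sum_distrib_right)
  finally show "x * y = y * x" .
qed

end


section \<open>Central elements and compatible families\<close>

locale groupoid_graded_ring_sigma = groupoid_graded_ring G R
  for G :: "('g, 'm) category_scheme" (structure) and R :: "'g \<Rightarrow> 'a::ring_1 set" +
  fixes a b :: "'g \<Rightarrow> nat \<Rightarrow> 'a"
  assumes data: "sigma_data G R a b"
begin

lemma a_mem: "s \<in> Mor G \<Longrightarrow> a s i \<in> R s"
  and b_mem: "s \<in> Mor G \<Longrightarrow> b (minv G s) i \<in> R (minv G s)"
  and finite_data: "s \<in> Mor G \<Longrightarrow> finite {i. \<not> (a s i = 0 \<and> b (minv G s) i = 0)}"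
  and Sum_any_data: "s \<in> Mor G \<Longrightarrow> Sum_any (\<lambda>i. a s i * b (minv G s) i) = unit_at (tgt G s)"
  using data by (auto simp: sigma_data_def)

lemma finite_data_imp:
  assumes "s \<in> Mor G" "\<And>i. a s i = 0 \<Longrightarrow> f i = 0"
  shows "finite {i. f i \<noteq> 0}"
  by (rule finite_subset[OF _ finite_data[OF assms(1)]]) (use assms(2) in auto)

lemma sigma_central:
  assumes s: "s \<in> Mor G" and x: "x \<in> ring_center"
  shows "sigma G a b s (x * unit_at (src G s)) = x * unit_at (tgt G s)"
proof -
  have "a s i * (x * unit_at (src G s)) * b (minv G s) i = x * (a s i * b (minv G s) i)" for i
  proof -
    have "a s i * unit_at (src G s) = a s i"
      using homogeneous_mult_component_one[OF s a_mem[OF s] src_closed[OF s]] by simp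
    moreover have "a s i * x = x * a s i"
      using x by (simp add: ring_center_iff)
    moreover have "unit_at (src G s) * x = x * unit_at (src G s)"
      using x by (simp add: ring_center_iff)
    ultimately show ?thesis
      by (metis mult.assoc)
  qed
  then show ?thesis
    unfolding sigma_def
    using Sum_any_right_distrib[OF finite_data_imp[OF s, of "\<lambda>i. a s i * b (minv G s) i"], of x]
      Sum_any_data[OF s] by simp
qed

lemma central_imp_commutant_family:
  assumes x: "x \<in> ring_center"
  shows "(\<lambda>e. x * unit_at e) \<in> fin_families (ob G) (\<lambda>e. commutant (R e))"
proof -
  have "finite {e. x * unit_at e \<noteq> 0}"
    by (rule finite_subset[OF _ finite_part[of 1]]) auto
  moreover have "x * unit_at e \<in> commutant (R e)" if e: "e \<in> ob G" for e
  proof -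
    have "x * unit_at e * y = y * (x * unit_at e)" if y: "y \<in> R e" for y
    proof -
      have "y * unit_at e = y" "unit_at e * y = y"
        using e y homogeneous_mult_component_one[of e y e] component_one_mult_homogeneous[of e y e]
        by (auto simp: ob_def)
      moreover have "x * y = y * x"
        using x by (simp add: ring_center_iff)
      moreover have "x * unit_at e = unit_at e * x"
        using x by (simp add: ring_center_iff)
      ultimately show ?thesis
        by (metis mult.assoc)
    qed
    then show ?thesis
      by (simp add: commutant_def)
  qed
  ultimately show "(\<lambda>e. x * unit_at e) \<in> fin_families (ob G) (\<lambda>e. commutant (R e))"
    by (simp add: fin_families_def component_one_not_ob)
qed

text \<open>The degree \<open>s\<inverse>\<close> elements \<open>b\<^sub>i\<close> carry \<open>y\<close> into \<open>R\<^bsub>d(s)\<^esub>\<close>, where \<open>x\<close> may be moved past it.\<close>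

lemma sigma_mult_homogeneous:
  assumes s: "s \<in> Mor G" and x: "x \<in> commutant (R (src G s))" and y: "y \<in> R s"
  shows "sigma G a b s x * y = y * x"
proof -
  note inv = is_inverse_minv[OF s, unfolded is_inverse_def]
  have shift: "a s i * x * b (minv G s) i * y = (a s i * b (minv G s) i) * (y * x)" for i
  proof -
    have "b (minv G s) i * y \<in> R (src G s)"
      using mult_mem[OF _ s _ b_mem[OF s] y] inv by simp
    then have "x * (b (minv G s) i * y) = b (minv G s) i * y * x"
      using x by (simp add: commutant_def)
    then show ?thesis
      by (simp add: mult.assoc)
  qed
  have "sigma G a b s x * y = Sum_any (\<lambda>i. (a s i * b (minv G s) i) * (y * x))"
    unfolding sigma_def by (subst Sum_any_left_distrib[OF finite_data_imp[OF s]]) (simp_all add: shift)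
  also have "\<dots> = unit_at (tgt G s) * (y * x)"
    using Sum_any_left_distrib[OF finite_data_imp[OF s, of "\<lambda>i. a s i * b (minv G s) i"], of "y * x"]
      Sum_any_data[OF s] by simp
  also have "\<dots> = y * x"
    using component_one_mult_homogeneous[OF s y tgt_in_ob[OF s]] by (simp flip: mult.assoc)
  finally show ?thesis .
qed

text \<open>At an identity, \<open>\<sigma>\<^sub>e\<close> is multiplication by \<open>1\<^sub>e\<close> on the commutant of \<open>R\<^sub>e\<close>.\<close>

lemma sigma_fixed_at_ob:
  assumes e: "e \<in> ob G" and x: "x \<in> commutant (R e)" and fixed: "sigma G a b e x = x"
  shows "x * unit_at e = x" and "unit_at e * x = x"
proof -
  have em: "e \<in> Mor G" "src G e = e" "tgt G e = e"
    using e by (auto simp: ob_def)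
  have comm: "x * unit_at e = unit_at e * x"
    using x part_mem[OF em(1)] by (simp add: commutant_def)
  have "a e i * x * b e i = x * (a e i * b e i)" for i
    using x a_mem[OF em(1)] by (simp add: commutant_def mult.assoc[symmetric])
  then have "sigma G a b e x = x * unit_at e"
    unfolding sigma_def
    using Sum_any_right_distrib[OF finite_data_imp[OF em(1), of "\<lambda>i. a e i * b e i"], of x]
      Sum_any_data[OF em(1)] em minv_ob[OF e] by simp
  with fixed comm show "x * unit_at e = x" "unit_at e * x = x"
    by simp_all
qed

text \<open>
  If each \<open>x\<^sub>e\<close> lives in the corner cut out by \<open>1\<^sub>e\<close>, orthogonality of these idempotents lets an
  element of one corner see a single summand of \<open>\<Sum>\<^sub>e x\<^sub>e\<close>.
\<close>

lemma
  assumes fam: "x \<in> fin_families (ob G) A"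
    and local_unit: "\<And>e. e \<in> ob G \<Longrightarrow> x e * unit_at e = x e \<and> unit_at e * x e = x e"
    and e: "e \<in> ob G"
  shows Sum_any_mult_local: "unit_at e * y = y \<Longrightarrow> Sum_any x * y = x e * y"
    and mult_Sum_any_local: "y * unit_at e = y \<Longrightarrow> y * Sum_any x = y * x e"
proof -
  have fin: "finite {f. x f \<noteq> 0}" and out: "\<And>f. f \<notin> ob G \<Longrightarrow> x f = 0"
    using fam by (auto simp: fin_families_def)
  have orth: "x f * unit_at e = 0" "unit_at e * x f = 0" if "f \<noteq> e" for f
  proof -
    show "x f * unit_at e = 0"
    proof (cases "f \<in> ob G")
      case True
      then have "x f * unit_at e = x f * (unit_at f * unit_at e)"
        using local_unit by (simp flip: mult.assoc)
      with True e that show ?thesis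
        by (simp add: component_one_orthogonal)
    qed (simp add: out)
    show "unit_at e * x f = 0"
    proof (cases "f \<in> ob G")
      case True
      then have "unit_at e * x f = (unit_at e * unit_at f) * x f"
        using local_unit by (simp add: mult.assoc)
      with True e that show ?thesis
        by (simp add: component_one_orthogonal)
    qed (simp add: out)
  qed
  show "Sum_any x * y = x e * y" if y: "unit_at e * y = y"
  proof -
    have "x f * y = (if f = e then x f * y else 0)" for f
      using orth(1)[of f] y by (metis mult.assoc mult_zero_left)
    then have "Sum_any (\<lambda>f. x f * y) = Sum_any (\<lambda>f. if f = e then x f * y else 0)"
      by metis
    then show ?thesis
      by (simp add: Sum_any_left_distrib[OF fin])
  qed
  show "y * Sum_any x = y * x e" if y: "y * unit_at e = y"
  proof -
    have "y * x f = (if f = e then y * x f else 0)" for f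
      using orth(2)[of f] y by (metis mult.assoc mult_zero_right)
    then have "Sum_any (\<lambda>f. y * x f) = Sum_any (\<lambda>f. if f = e then y * x f else 0)"
      by metis
    then show ?thesis
      by (simp add: Sum_any_right_distrib[OF fin])
  qed
qed

lemma compatible_sum_central:
  assumes fam: "x \<in> fin_families (ob G) (\<lambda>e. commutant (R e))"
    and compat: "\<And>s. s \<in> Mor G \<Longrightarrow> sigma G a b s (x (src G s)) = x (tgt G s)"
  shows "Sum_any x \<in> ring_center"
proof (rule central_if_commutes_homogeneous)
  fix s y
  assume s: "s \<in> Mor G" and y: "y \<in> R s"
  have mem: "x e \<in> commutant (R e)" if "e \<in> ob G" for e
    using fam that by (simp add: fin_families_def)
  have local_unit: "x e * unit_at e = x e \<and> unit_at e * x e = x e" if e: "e \<in> ob G" for e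
    using sigma_fixed_at_ob[OF e mem[OF e]] compat[of e] e by (simp add: ob_def)
  have "Sum_any x * y = x (tgt G s) * y"
    using component_one_mult_homogeneous[OF s y tgt_in_ob[OF s]]
    by (intro Sum_any_mult_local[OF fam local_unit tgt_in_ob[OF s]]) simp_all
  also have "\<dots> = sigma G a b s (x (src G s)) * y"
    by (simp add: compat[OF s])
  also have "\<dots> = y * x (src G s)"
    by (rule sigma_mult_homogeneous[OF s mem[OF src_in_ob[OF s]] y])
  also have "\<dots> = y * Sum_any x"
    using homogeneous_mult_component_one[OF s y src_closed[OF s]]
    by (intro mult_Sum_any_local[OF fam local_unit src_in_ob[OF s], symmetric]) simp_all
  finally show "Sum_any x * y = y * Sum_any x" .
qed

theorem center_eq_compatible_sums:
  "(ring_center :: 'a set) =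
      {Sum_any x | x. x \<in> fin_families (ob G) (\<lambda>e. commutant (R e)) \<and>
         (\<forall>s\<in>Mor G. sigma G a b s (x (src G s)) = x (tgt G s))}"
proof (rule Set.set_eqI, rule iffI)
  fix z :: 'a
  assume z: "z \<in> ring_center"
  have "z = Sum_any (\<lambda>e. z * unit_at e)"
    by (simp only: Sum_any_mult_component_one)
  then show "z \<in> {Sum_any x | x. x \<in> fin_families (ob G) (\<lambda>e. commutant (R e)) \<and>
         (\<forall>s\<in>Mor G. sigma G a b s (x (src G s)) = x (tgt G s))}"
    using central_imp_commutant_family[OF z] sigma_central[OF _ z] by blast
qed (use compatible_sum_central in blast)


section \<open>Disjoint unions of groups\<close>

lemma disjoint_union_src_eq_tgt:
  assumes "disjoint_union_of_groups G" "s \<in> Mor G"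
  shows "src G s = tgt G s"
proof -
  obtain e where "s \<in> vertex_group G e"
    using assms unfolding disjoint_union_of_groups_def by blast
  then show ?thesis
    by (simp add: vertex_group_def)
qed

lemma component_one_central:
  assumes dis: "disjoint_union_of_groups G" and e: "e \<in> ob G"
  shows "unit_at e \<in> ring_center"
proof (rule central_if_commutes_homogeneous)
  fix s y
  assume s: "s \<in> Mor G" and y: "y \<in> R s"
  show "unit_at e * y = y * unit_at e"
    using component_one_mult_homogeneous[OF s y e]
      homogeneous_mult_component_one[OF s y ob_imp_Mor[OF e]] disjoint_union_src_eq_tgt[OF dis s]
    by simp
qed

text \<open>
  An invariant at \<open>e\<close>, extended by \<open>0\<close> at the other objects, is a compatible family whose sum is
  that invariant; so invariants are themselves central.
\<close>

lemma invariants_eq: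
  assumes dis: "disjoint_union_of_groups G" and e: "e \<in> ob G"
  shows "invariants G R a b e = {x \<in> ring_center. x * unit_at e = x}"
proof (intro equalityI subsetI)
  fix x
  assume "x \<in> invariants G R a b e"
  then have x: "x \<in> commutant (R e)" "\<And>s. s \<in> vertex_group G e \<Longrightarrow> sigma G a b s x = x"
    by (auto simp: invariants_def)
  let ?x = "\<lambda>f. if f = e then x else 0"
  have "?x \<in> fin_families (ob G) (\<lambda>e. commutant (R e))"
    using x(1) e add_subgroup_zero[OF add_subgroup_commutant] by (auto simp: fin_families_def)
  moreover have "sigma G a b s (?x (src G s)) = ?x (tgt G s)" if s: "s \<in> Mor G" for s
  proof (cases "src G s = e")
    case True
    then show ?thesis
      using x(2)[of s] disjoint_union_src_eq_tgt[OF dis s] s by (simp add: vertex_group_def)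
  next
    case False
    then show ?thesis
      using disjoint_union_src_eq_tgt[OF dis s] by (simp add: sigma_def)
  qed
  ultimately have "Sum_any ?x \<in> ring_center"
    by (rule compatible_sum_central)
  moreover have "x * unit_at e = x"
    using x e by (intro sigma_fixed_at_ob) (auto simp: vertex_group_def ob_def)
  ultimately show "x \<in> {x \<in> ring_center. x * unit_at e = x}"
    by simp
next
  fix x
  assume "x \<in> {x \<in> ring_center. x * unit_at e = x}"
  then have x: "x \<in> ring_center" "x * unit_at e = x"
    by auto
  have "x \<in> commutant (R e)"
    using x(1) by (simp add: ring_center_def commutant_def)
  moreover have "sigma G a b s x = x" if "s \<in> vertex_group G e" for s
    using sigma_central[OF _ x(1), of s] that x(2) by (auto simp: vertex_group_def)
  ultimately show "x \<in> invariants G R a b e"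
    by (simp add: invariants_def)
qed

lemma ring_in_invariants:
  assumes dis: "disjoint_union_of_groups G" and e: "e \<in> ob G"
  shows "ring_in (invariants G R a b e)"
proof -
  let ?I = "{x \<in> ring_center. x * unit_at e = x}"
  have "add_subgroup ?I"
    by (auto simp: add_subgroup_def ring_center_iff algebra_simps)
  moreover have "x * y \<in> ?I" if "x \<in> ?I" "y \<in> ?I" for x y
  proof -
    have comm: "x * z = z * x" "y * z = z * y" for z
      using that by (simp_all add: ring_center_iff)
    have "x * y * z = z * (x * y)" for z
      using comm[of z] by (metis mult.assoc)
    moreover have "x * y * unit_at e = x * y"
      using that(2) by (simp add: mult.assoc)
    ultimately show ?thesis
      by (simp add: ring_center_iff)
  qed
  moreover have "unit_at e \<in> ?I"
    using component_one_central[OF dis e] component_one_orthogonal[OF e e] by simp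
  moreover have "unit_at e * x = x \<and> x * unit_at e = x" if "x \<in> ?I" for x
  proof -
    have "x * unit_at e = unit_at e * x"
      using that unfolding ring_center_iff by blast
    then show ?thesis
      using that by simp
  qed
  ultimately show ?thesis
    unfolding ring_in_def invariants_eq[OF dis e] by blast
qed

theorem center_direct_sum_invariants:
  assumes dis: "disjoint_union_of_groups G"
  shows "ring_direct_sum (ob G) (invariants G R a b) ring_center"
proof -
  let ?F = "fin_families (ob G) (invariants G R a b)"
  have local_unit: "x e * unit_at e = x e \<and> unit_at e * x e = x e"
    if "x \<in> ?F" "e \<in> ob G" for x e
  proof -
    have xe: "x e \<in> ring_center" "x e * unit_at e = x e"
      using that invariants_eq[OF dis that(2)] by (auto simp: fin_families_def)
    then have "x e * unit_at e = unit_at e * x e"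
      unfolding ring_center_iff by blast
    with xe(2) show ?thesis
      by simp
  qed
  have proj: "Sum_any x * unit_at e = x e" if x: "x \<in> ?F" for x e
  proof (cases "e \<in> ob G")
    case True
    then show ?thesis
      using Sum_any_mult_local[OF x local_unit[OF x] True, of "unit_at e"] local_unit[OF x True]
        component_one_orthogonal[OF True True] by simp
  next
    case False
    then show ?thesis
      using x by (simp add: fin_families_def component_one_not_ob)
  qed
  have "bij_betw Sum_any ?F ring_center"
  proof (rule bij_betw_imageI)
    show "inj_on Sum_any ?F"
    proof (rule inj_onI, rule ext)
      fix x y e
      assume "x \<in> ?F" "y \<in> ?F" "Sum_any x = Sum_any y"
      then show "x e = y e"
        using proj[of x e] proj[of y e] by simp
    qed
    show "Sum_any ` ?F = ring_center"
    proof (intro equalityI subsetI)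
      fix z
      assume "z \<in> Sum_any ` ?F"
      then obtain x where x: "x \<in> ?F" "z = Sum_any x"
        by blast
      have "x \<in> fin_families (ob G) (\<lambda>e. commutant (R e))"
        using x(1) by (auto simp: fin_families_def invariants_def)
      moreover have "sigma G a b s (x (src G s)) = x (tgt G s)" if s: "s \<in> Mor G" for s
      proof -
        have "x (src G s) \<in> invariants G R a b (src G s)"
          using x(1) src_in_ob[OF s] by (simp add: fin_families_def)
        then show ?thesis
          using s disjoint_union_src_eq_tgt[OF dis s]
          by (simp add: invariants_def vertex_group_def)
      qed
      ultimately show "z \<in> ring_center"
        unfolding x(2) by (rule compatible_sum_central)
    next
      fix z :: 'a
      assume z: "z \<in> ring_center"
      have "z * unit_at e \<in> invariants G R a b e" if e: "e \<in> ob G" for e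
      proof -
        have "z * unit_at e \<in> ring_center"
        unfolding ring_center_iff
        proof
          fix w
          have "z * w = w * z" "unit_at e * w = w * unit_at e"
            using z component_one_central[OF dis e] by (simp_all add: ring_center_iff)
          then show "z * unit_at e * w = w * (z * unit_at e)"
            by (metis mult.assoc)
        qed
        then show ?thesis
          unfolding invariants_eq[OF dis e]
          using component_one_orthogonal[OF e e] by (simp add: mult.assoc)
      qed
      then have "(\<lambda>e. z * unit_at e) \<in> ?F"
        using central_imp_commutant_family[OF z] by (simp add: fin_families_def)
      moreover have "z = Sum_any (\<lambda>e. z * unit_at e)"
        by (simp only: Sum_any_mult_component_one)
      ultimately show "z \<in> Sum_any ` ?F"
        by blast
    qed
  qed
  moreover have "Sum_any x * Sum_any y = Sum_any (\<lambda>e. x e * y e)" if x: "x \<in> ?F" and y: "y \<in> ?F" for x y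
  proof -
    have fin: "finite {e. x e \<noteq> 0}" and out: "\<And>e. e \<notin> ob G \<Longrightarrow> x e = 0"
      using x by (auto simp: fin_families_def)
    have "x e * Sum_any y = x e * y e" for e
    proof (cases "e \<in> ob G")
      case True
      then show ?thesis
        using mult_Sum_any_local[OF y local_unit[OF y] True] local_unit[OF x True] by simp
    qed (simp add: out)
    then show ?thesis
      by (simp add: Sum_any_left_distrib[OF fin])
  qed
  ultimately show ?thesis
    using ring_in_invariants[OF dis] by (simp add: ring_direct_sum_def direct_sum_def ring_in_def)
qed

end

theorem theorem6:
  fixes G :: "('g, 'm) category_scheme"
    and R :: "'g \<Rightarrow> 'a::ring_1 set"
    and a b :: "'g \<Rightarrow> nat \<Rightarrow> 'a"
  assumes "groupoid G"
    and "strongly_graded G R"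
    and "sigma_data G R a b"
  shows "(ring_center :: 'a set) =
      {Sum_any x | x. x \<in> fin_families (ob G) (\<lambda>e. commutant (R e)) \<and>
         (\<forall>s\<in>Mor G. sigma G a b s (x (src G s)) = x (tgt G s))}
    \<and> (disjoint_union_of_groups G \<longrightarrow>
        ring_direct_sum (ob G) (invariants G R a b) ring_center)"
proof -
  have "graded G R"
    using assms(2) by (simp add: strongly_graded_def)
  with assms interpret groupoid_graded_ring_sigma G R a b
    by (intro groupoid_graded_ring_sigma.intro groupoid_graded_ring.intro
        groupoid_graded_ring_axioms.intro groupoid_graded_ring_sigma_axioms.intro)
  show ?thesis
    using center_eq_compatible_sums center_direct_sum_invariants by blast
qed

end
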